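(* Let $\gamma\in\mathbb R$ with $\gamma\ne0$, $|\gamma|\neq1$. Then: (i) the estimate $$\|uv\|_{X^{s,-1/2+}_{per}}\lesssim\|u\|_{Y^{s-1/2,1/2}_{\gamma,per}}\|v\|_{X^{s,1/2}_{per}}$$ fails for any $s<1/2$; (ii) the estimate $$\|\partial_x(u\bar v)\|_{Y^{s-1/2,-1/2+}_{\gamma,per}}\lesssim\|u\|_{X^{s,1/2}_{per}}\|v\|_{X^{s,1/2}_{per}}$$ fails for any $s<1/2$.
   Context: Functions $u(t,x)$ are complex-valued on $\mathbb R\times\mathbb T$, with $\mathbb T=\mathbb R/L\mathbb Z$ and $L>0$ a fixed period; $\widehat u(\tau,n)$ ($\tau\in\mathbb R,n\in\mathbb Z$) is the Fourier transform in $t$ and the $n$-th Fourier coefficient in $x$ (with respect to $e^{2\pi inx/L}$). With $\langle x\rangle=1+|x|$, $$\|u\|_{X^{s,b}_{per}}=\Big(\sum_{n\in\mathbb Z}\int_{\mathbb R}\langle\tau+n^2\rangle^{2b}\langle n\rangle^{2s}|\widehat u(\tau,n)|^2d\tau\Big)^{1/2},$$ $$\|u\|_{Y^{s,b}_{\gamma,per}}=\Big(\sum_{n\in\mathbb Z}\int_{\mathbb R}\langle\tau+\gamma|n|n\rangle^{2b}\langle n\rangle^{2s}|\widehat u(\tau,n)|^2d\tau\Big)^{1/2}.$$ The exponent $-1/2+$ denotes $-1/2+\epsilon$ with $\epsilon>0$ small. "The estimate fails" means that (for every small $\epsilon>0$) there is no constant $C$ such that the inequality with $\lesssim$ replaced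 by $\le C\,\cdot$ holds for all $u,v$ for which the right-hand side is finite. *)

theory Defs
  imports "HOL-Analysis.Analysis"
begin

text \<open>
  A function on \<open>\<real> \<times> \<real>/L\<int>\<close> is represented by a curried function of \<open>(t, x)\<close> that is
  \<open>L\<close>-periodic in \<open>x\<close>. Integrability over one period strip is what makes the space-time
  Fourier transform below an absolutely convergent integral rather than a default value.
\<close>

definition periodic_integrable :: "real \<Rightarrow> (real \<Rightarrow> real \<Rightarrow> complex) set" where
  "periodic_integrable L =
     {u. (\<forall>t x. u t (x + L) = u t x) \<and>
         set_integrable lborel (UNIV \<times> {0..L}) (\<lambda>(t, x). u t x)}"

definition fourier_coeff :: "real \<Rightarrow> (real \<Rightarrow> complex) \<Rightarrow> int \<Rightarrow> complex" where
  "fourier_coeff L f n =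
     (LINT x:{0..L}|lborel. f x * cis (- (2 * pi * of_int n * x / L))) / of_real L"

text \<open>
  Convention in time: kernel \<open>exp (- i t \<tau>)\<close> without normalising factor. With this sign, the mode
  \<open>exp (i (2 \<pi> n x / L - n\<^sup>2 t))\<close> sits at \<open>\<tau> = - n\<^sup>2\<close>, where the weight of the \<open>X\<close>-norm below is
  smallest.
\<close>

definition st_fourier :: "real \<Rightarrow> (real \<Rightarrow> real \<Rightarrow> complex) \<Rightarrow> real \<Rightarrow> int \<Rightarrow> complex" where
  "st_fourier L u \<tau> n = (LINT t|lborel. fourier_coeff L (u t) n * cis (- (t * \<tau>)))"

definition jap :: "real \<Rightarrow> real" where
  "jap x = 1 + \<bar>x\<bar>"

definition ennreal_sqrt :: "ennreal \<Rightarrow> ennreal" where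
  "ennreal_sqrt x = (if x = \<infinity> then \<infinity> else ennreal (sqrt (enn2real x)))"

text \<open>
  The norms take the Fourier transform \<open>U\<close> of the function as their argument, so that they also
  apply to distributional derivatives.
\<close>

definition bourgain_norm ::
    "(int \<Rightarrow> real) \<Rightarrow> real \<Rightarrow> real \<Rightarrow> (real \<Rightarrow> int \<Rightarrow> complex) \<Rightarrow> ennreal" where
  "bourgain_norm h s b U =
     ennreal_sqrt (\<Sum>\<^sub>\<infinity>n\<in>UNIV. \<integral>\<^sup>+ \<tau>.
       ennreal (jap (\<tau> + h n) powr (2 * b) * jap (of_int n) powr (2 * s) * (cmod (U \<tau> n))\<^sup>2) \<partial>lborel)"

definition X_norm :: "real \<Rightarrow> real \<Rightarrow> (real \<Rightarrow> int \<Rightarrow> complex) \<Rightarrow> ennreal" where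
  "X_norm s b U = bourgain_norm (\<lambda>n. (of_int n)\<^sup>2) s b U"

definition Y_norm :: "real \<Rightarrow> real \<Rightarrow> real \<Rightarrow> (real \<Rightarrow> int \<Rightarrow> complex) \<Rightarrow> ennreal" where
  "Y_norm \<gamma> s b U = bourgain_norm (\<lambda>n. \<gamma> * \<bar>of_int n\<bar> * of_int n) s b U"

text \<open>
  The Fourier transform of \<open>\<partial>\<^sub>x w\<close>, in the sense of periodic distributions, in terms of the
  Fourier transform of \<open>w\<close>. Lemma \<open>st_fourier_classical_deriv\<close> confirms the agreement with the
  classical derivative.
\<close>

definition dx_hat :: "real \<Rightarrow> (real \<Rightarrow> int \<Rightarrow> complex) \<Rightarrow> real \<Rightarrow> int \<Rightarrow> complex" where
  "dx_hat L W \<tau> n = (2 * of_real pi * \<i> * of_int n / of_real L) * W \<tau> n"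

lemma fourier_coeff_classical_deriv:
  fixes f f' :: "real \<Rightarrow> complex"
  assumes L: "L > 0"
    and per: "\<And>x. f (x + L) = f x"
    and der: "\<And>x. (f has_vector_derivative f' x) (at x)"
    and cont: "continuous_on UNIV f'"
  shows "fourier_coeff L f' n = (2 * of_real pi * \<i> * of_int n / of_real L) * fourier_coeff L f n"
proof -
  define c where "c = - (2 * pi * of_int n / L)"
  define e where "e = (\<lambda>x. cis (c * x))"
  have e_der: "(e has_vector_derivative (\<i> * of_real c * e x)) (at x within S)" for x S
  proof -
    have "((\<lambda>z. exp (\<i> * of_real c * z)) has_field_derivative
            \<i> * of_real c * exp (\<i> * of_real c * of_real x)) (at (of_real x))"
      by (auto intro!: derivative_eq_intros)
    from has_vector_derivative_real_field[OF this, of S]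
    show ?thesis
      by (simp add: e_def cis_conv_exp mult.assoc)
  qed
  have e_cont: "continuous_on S e" for S
    unfolding e_def by (intro continuous_intros)
  have f_cont: "continuous_on S f" for S
    using der by (meson continuous_at_imp_continuous_on has_vector_derivative_continuous)
  have f'_cont: "continuous_on S f'" for S
    using cont continuous_on_subset by blast
  have i1: "set_integrable lborel {0..L} (\<lambda>x. f' x * e x)"
    by (intro borel_integrable_atLeastAtMost' continuous_intros f'_cont e_cont)
  have i2: "set_integrable lborel {0..L} (\<lambda>x. f x * e x)"
    by (intro borel_integrable_atLeastAtMost' continuous_intros f_cont e_cont)
  have "(LBINT x. indicator {0..L} x *\<^sub>R (f' x * e x + f x * (\<i> * of_real c * e x)))
          = f L * e L - f 0 * e 0"
  proof (rule integral_FTC_Icc)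
    show "0 \<le> L" using L by simp
    show "((\<lambda>x. f x * e x) has_vector_derivative f' x * e x + f x * (\<i> * of_real c * e x))
            (at x within {0..L})" for x
      using has_vector_derivative_mult[OF has_vector_derivative_at_within[OF der] e_der]
      by (simp add: add.commute)
    show "continuous_on {0..L} (\<lambda>x. f' x * e x + f x * (\<i> * of_real c * e x))"
      by (intro continuous_intros f'_cont f_cont e_cont)
  qed
  moreover have "c * L = 2 * pi * of_int (- n)"
    using L by (simp add: c_def)
  then have "e L = 1"
    unfolding e_def by (metis cis_multiple_2pi Ints_of_int)
  moreover have "f L = f 0" using per[of 0] by simp
  moreover have "e 0 = 1" by (simp add: e_def)
  ultimately have "(LINT x:{0..L}|lborel. f' x * e x + (\<i> * of_real c) * (f x * e x)) = 0"
    by (simp add: set_lebesgue_integral_def algebra_simps)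
  then have "(LINT x:{0..L}|lborel. f' x * e x)
      + (\<i> * of_real c) * (LINT x:{0..L}|lborel. f x * e x) = 0"
    using i1 i2 by (subst (asm) set_integral_add) auto
  moreover have "cis (- (2 * pi * of_int n * x / L)) = e x" for x
    by (simp add: e_def c_def)
  ultimately show ?thesis
    unfolding fourier_coeff_def by (simp add: c_def add_eq_0_iff field_simps)
qed

lemma st_fourier_classical_deriv:
  fixes w w' :: "real \<Rightarrow> real \<Rightarrow> complex"
  assumes "L > 0"
    and "\<And>t x. w t (x + L) = w t x"
    and "\<And>t x. (w t has_vector_derivative w' t x) (at x)"
    and "\<And>t. continuous_on UNIV (w' t)"
  shows "st_fourier L w' = dx_hat L (st_fourier L w)"
proof (intro ext)
  fix \<tau> n
  have "fourier_coeff L (w' t) n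
      = (2 * of_real pi * \<i> * of_int n / of_real L) * fourier_coeff L (w t) n" for t
    by (rule fourier_coeff_classical_deriv) (use assms in auto)
  then show "st_fourier L w' \<tau> n = dx_hat L (st_fourier L w) \<tau> n"
    unfolding st_fourier_def dx_hat_def by (simp only: mult.assoc integral_mult_right_zero)
qed

end

theory Submission
  imports Defs "HOL-Probability.Probability"
begin

text \<open>
  Test the estimates on Gaussian-in-time plane waves \<open>exp (- a t\<^sup>2) exp (i (2 \<pi> n x / L + \<omega> t))\<close> lying
  on the characteristic curves of the two input norms. For the product of a \<open>Y\<close>-wave of frequency
  \<open>K > 0\<close> with an \<open>X\<close>-wave of frequency \<open>M\<close>, the distance to the \<open>X\<close>-curve is
  \<open>\<bar>2 K (M - \<alpha> K)\<bar>\<close> with \<open>\<alpha> = (\<gamma> - 1) / 2\<close>; for the product of an \<open>X\<close>-wave of frequency \<open>K + M\<close>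
  with the conjugate of one of frequency \<open>M\<close>, the distance to the \<open>Y\<close>-curve is the same. By
  Dirichlet's theorem it stays bounded along a sequence \<open>K \<rightarrow> \<infinity>\<close>, so the weights in \<open>\<tau>\<close> are
  irrelevant. Since \<open>\<alpha> \<noteq> 0, -1\<close>, all frequencies are comparable to \<open>K\<close> and both estimates force
  \<open>K powr (1/2 - s)\<close> to be bounded.
\<close>

section \<open>Diophantine approximation: bounded resonance at arbitrarily large frequencies\<close>

text \<open>
  Dirichlet gives \<open>k \<le> Q\<close> with \<open>\<bar>k \<alpha> - h\<bar> < 1/Q\<close>, where \<open>k\<close> may stay bounded as \<open>Q\<close> grows (rational
  \<open>\<alpha>\<close>). Multiplying \<open>k\<close> and \<open>h\<close> by \<open>\<lfloor>sqrt (Q / k)\<rfloor>\<close> makes the denominator large and keeps the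
  resonance bounded.
\<close>

lemma bounded_resonance_unbounded:
  fixes \<alpha> R :: real
  shows "\<exists>K M :: int. 1 \<le> K \<and> R < of_int K \<and> \<bar>of_int K * (of_int M - \<alpha> * of_int K)\<bar> \<le> 1"
proof -
  \<comment> \<open>The threshold fits the bound \<open>Q \<le> 4 * (j * k)\<^sup>2\<close> reached
    below, which then forces \<open>R < j * k\<close>.\<close>
  obtain Q :: nat where Q: "4 * R\<^sup>2 + 1 < real Q"
    using reals_Archimedean2 by blast
  then have Qpos: "Q > 0"
    by (metis add_increasing mult_nonneg_nonneg not_gr_zero of_nat_0 not_less zero_le_one zero_le_numeral zero_le_power2 order_less_le_trans)
  obtain h k where k: "0 < k" "k \<le> int Q" and hk: "\<bar>of_int k * \<alpha> - of_int h\<bar> < 1 / Q"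
    using Dirichlet_approx[OF Qpos] by blast
  define x where "x = sqrt (Q / k)"
  define j where "j = \<lfloor>x\<rfloor>"
  have x2: "x\<^sup>2 * k = Q"
    using k by (simp add: x_def)
  have "1 \<le> x"
    using k by (simp add: x_def)
  then have j1: "1 \<le> j" and jx: "of_int j \<le> x" and xj: "x < of_int j + 1"
    unfolding j_def by linarith+
  have "x \<le> 2 * of_int j"
    using xj j1 by linarith
  \<comment> \<open>This half of the choice of \<open>j\<close> keeps the rescaled resonance
    bounded; the opposite bound \<open>x \<le> 2 * j\<close> makes the denominator large.\<close>
  have j2: "(of_int j)\<^sup>2 * of_int k \<le> (Q::real)"
    unfolding x2[symmetric] using k jx j1 by (intro mult_right_mono power_mono) auto
  have "Q = x\<^sup>2 * k" using x2 by simp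
  also have "\<dots> \<le> (2 * of_int j)\<^sup>2 * of_int k"
    using \<open>x \<le> 2 * of_int j\<close> \<open>1 \<le> x\<close> k by (intro mult_right_mono power_mono) auto
  also have "\<dots> \<le> (2 * of_int j)\<^sup>2 * (of_int k * of_int k)"
  proof (rule mult_left_mono)
    have "(1::real) \<le> of_int k" using k by simp
    then show "of_int k \<le> (of_int k * of_int k :: real)" by (simp add: mult_le_cancel_left1)
  qed simp
  also have "\<dots> = 4 * (of_int (j * k))\<^sup>2"
    by (simp add: power2_eq_square algebra_simps)
  finally have "R\<^sup>2 < (of_int (j * k))\<^sup>2"
    using Q by linarith
  moreover have "(0::real) \<le> of_int (j * k)"
    using j1 k by simp
  ultimately have R: "R < of_int (j * k)"
    by (metis power_less_imp_less_base)
  \<comment> \<open>Scaling \<open>k\<close> and \<open>h\<close> by \<open>j\<close> multiplies the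
    resonance by the square of \<open>j\<close>, and the factor \<open>j\<^sup>2 * k \<le> Q\<close>
    cancels the Dirichlet error \<open>1 / Q\<close>.\<close>
  have "\<bar>of_int (j * k) * (of_int (j * h) - \<alpha> * of_int (j * k))\<bar>
      = ((of_int j)\<^sup>2 * of_int k) * \<bar>of_int k * \<alpha> - of_int h\<bar>"
  proof -
    have "of_int (j * k) * (of_int (j * h) - \<alpha> * of_int (j * k))
        = - (((of_int j)\<^sup>2 * of_int k) * (of_int k * \<alpha> - of_int h))"
      by (simp add: power2_eq_square algebra_simps)
    then show ?thesis
      using j1 k by (simp add: abs_mult)
  qed
  also have "\<dots> \<le> Q * (1 / Q)"
    using j2 hk k by (intro mult_mono) auto
  also have "\<dots> = 1" using Qpos by simp
  finally have "\<bar>of_int (j * k) * (of_int (j * h) - \<alpha> * of_int (j * k))\<bar> \<le> 1" .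
  moreover have "1 \<le> j * k"
    using j1 k by (metis int_one_le_iff_zero_less mult_pos_pos)
  ultimately show ?thesis
    using R by blast
qed

section \<open>Comparability of brackets and of their powers\<close>

lemma jap_pos [simp]: "0 < jap x"
  by (simp add: jap_def)

lemma jap_ge_1: "1 \<le> jap x"
  by (simp add: jap_def)

text \<open>Since \<open>M\<close> lies within 1 of \<open>\<alpha> * K\<close>, its size is that of
  \<open>K\<close> up to an additive 1, which the bracket absorbs. Only a lower bound on
  \<open>\<kappa>\<close> is assumed, so that one \<open>\<kappa>\<close> can serve several
  slopes.\<close>

lemma jap_of_int_comparable:
  fixes \<alpha> \<kappa> :: real
  assumes K: "1 \<le> (K::int)" and M: "\<bar>of_int M - \<alpha> * of_int K\<bar> \<le> 1" and \<alpha>: "\<alpha> \<noteq> 0"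
    and \<kappa>: "2 + \<bar>\<alpha>\<bar> + 2 / \<bar>\<alpha>\<bar> \<le> \<kappa>"
  shows "jap (of_int M) \<le> \<kappa> * jap (of_int K)" "jap (of_int K) \<le> \<kappa> * jap (of_int M)"
proof -
  define k where "k = real_of_int K"
  have k: "1 \<le> k" using K by (simp add: k_def)
  have M1: "\<bar>of_int M\<bar> \<le> \<bar>\<alpha>\<bar> * k + 1" "\<bar>\<alpha>\<bar> * k - 1 \<le> \<bar>of_int M\<bar>"
    using M k abs_mult[of \<alpha> k] by (auto simp: k_def[symmetric])
  have "jap (of_int M) \<le> (2 + \<bar>\<alpha>\<bar>) * (1 + k)"
    using M1(1) k unfolding jap_def by (simp add: algebra_simps)
  also have "\<dots> \<le> \<kappa> * (1 + k)"
    using \<kappa> k by (intro mult_right_mono) (auto intro: order_trans[rotated])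
  finally show "jap (of_int M) \<le> \<kappa> * jap (of_int K)"
    using k by (simp add: jap_def k_def)
  have "jap (of_int K) \<le> 2 * k"
    using k by (simp add: jap_def k_def)
  also have "\<dots> = 2 / \<bar>\<alpha>\<bar> * (\<bar>\<alpha>\<bar> * k)"
    using \<alpha> by simp
  also have "\<dots> \<le> 2 / \<bar>\<alpha>\<bar> * jap (of_int M)"
    using M1(2) by (intro mult_left_mono) (auto simp: jap_def)
  also have "\<dots> \<le> \<kappa> * jap (of_int M)"
    using \<kappa> by (intro mult_right_mono) (auto intro: order_trans[rotated] less_imp_le)
  finally show "jap (of_int K) \<le> \<kappa> * jap (of_int M)" .
qed

text \<open>For \<open>s \<ge> 0\<close> the bound on \<open>x\<close> is raised to the power
  \<open>s\<close>; for \<open>s < 0\<close> the bound on \<open>y\<close> is, with the order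
  reversed. The exponent \<open>\<bar>s\<bar>\<close> covers both signs.\<close>

lemma powr_comparable:
  fixes x y \<kappa> s :: real
  assumes "0 < x" "0 < y" "x \<le> \<kappa> * y" "y \<le> \<kappa> * x"
  shows "x powr s \<le> \<kappa> powr \<bar>s\<bar> * y powr s"
proof -
  have \<kappa>: "0 < \<kappa>"
    using assms by (metis less_le_trans zero_less_mult_pos2)
  show ?thesis
  proof (cases "0 \<le> s")
    case True
    then have "x powr s \<le> (\<kappa> * y) powr s"
      using assms by (intro powr_mono2) auto
    then show ?thesis
      using True \<kappa> assms by (simp add: powr_mult)
  next
    case False
    then have "(\<kappa> * x) powr s \<le> y powr s"
      using assms by (intro powr_mono2') auto
    then have "\<kappa> powr s * x powr s \<le> y powr s"
      using \<kappa> assms by (simp add: powr_mult)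
    then have "\<kappa> powr (- s) * (\<kappa> powr s * x powr s) \<le> \<kappa> powr (- s) * y powr s"
      by (intro mult_left_mono) auto
    then show ?thesis
      using False \<kappa> by (simp add: mult.assoc[symmetric] powr_add[symmetric])
  qed
qed

section \<open>Gaussian plane waves and their Fourier transform\<close>

text \<open>The Gaussian factor makes the wave integrable over a period strip. The family is closed
  under products, where the rates \<open>a\<close> add, and under conjugation, so every product
  below is again explicit.\<close>

definition wave :: "real \<Rightarrow> real \<Rightarrow> int \<Rightarrow> real \<Rightarrow> real \<Rightarrow> real \<Rightarrow> complex" where
  "wave a L N \<omega> t x = of_real (exp (- (a * t\<^sup>2))) * cis (2 * pi * of_int N * x / L + \<omega> * t)"

definition wave_hat :: "real \<Rightarrow> int \<Rightarrow> real \<Rightarrow> real \<Rightarrow> int \<Rightarrow> complex" where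
  "wave_hat a N \<omega> \<tau> n =
     (if n = N then of_real (sqrt (pi / a) * exp (- ((\<tau> - \<omega>)\<^sup>2 / (4 * a)))) else 0)"

lemma wave_mult:
  "wave a L N \<omega> t x * wave a' L N' \<omega>' t x = wave (a + a') L (N + N') (\<omega> + \<omega>') t x"
  by (simp add: wave_def cis_mult algebra_simps add_divide_distrib flip: of_real_mult exp_add)

lemma cnj_wave: "cnj (wave a L N \<omega> t x) = wave a L (- N) (- \<omega>) t x"
  by (simp add: wave_def cis_cnj)

text \<open>Orthogonality without computing an integral: differentiating the mode multiplies its
  \<open>n\<close>-th coefficient both by a multiple of \<open>N\<close> and by the same multiple of
  \<open>n\<close>, so the coefficient vanishes when these differ.\<close>

lemma fourier_coeff_cis:
  assumes L: "L > 0"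
  shows "fourier_coeff L (\<lambda>x. cis (2 * pi * of_int N * x / L)) n = (if n = N then 1 else 0)"
proof (cases "n = N")
  case True
  have "(LINT x:{0..L}|lborel. (1::complex)) = of_real L"
    using L by (simp add: set_integral_const scaleR_conv_of_real)
  then show ?thesis
    using L True by (simp add: fourier_coeff_def cis_mult)
next
  case False
  define c where "c = 2 * pi * of_int N / L"
  have der: "((\<lambda>x. cis (c * x)) has_vector_derivative (\<i> * of_real c * cis (c * x))) (at x)" for x
  proof -
    have "((\<lambda>z. exp (\<i> * of_real c * z)) has_field_derivative
            \<i> * of_real c * exp (\<i> * of_real c * of_real x)) (at (of_real x))"
      by (auto intro!: derivative_eq_intros)
    from has_vector_derivative_real_field[OF this, of UNIV] show ?thesis
      by (simp add: cis_conv_exp mult.assoc)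
  qed
  have per: "cis (c * (x + L)) = cis (c * x)" for x
  proof -
    have "cis (c * (x + L)) = cis (c * x) * cis (2 * pi * of_int N)"
      using L by (simp add: cis_mult c_def field_simps)
    then show ?thesis by (simp add: cis_multiple_2pi)
  qed
  have "fourier_coeff L (\<lambda>x. \<i> * of_real c * cis (c * x)) n
      = (2 * of_real pi * \<i> * of_int n / of_real L) * fourier_coeff L (\<lambda>x. cis (c * x)) n"
    by (rule fourier_coeff_classical_deriv[OF L per der]) (intro continuous_intros)
  moreover have "fourier_coeff L (\<lambda>x. \<i> * of_real c * cis (c * x)) n
      = \<i> * of_real c * fourier_coeff L (\<lambda>x. cis (c * x)) n"
    by (simp add: fourier_coeff_def mult.assoc)
  ultimately have "fourier_coeff L (\<lambda>x. cis (c * x)) n = 0"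
    using L False by (simp add: c_def field_simps)
  then show ?thesis
    using False by (simp add: c_def)
qed

text \<open>This is the characteristic function of the standard normal distribution after a
  rescaling of time.\<close>

lemma integral_gaussian_cis:
  assumes a: "a > 0"
  shows "(LINT t|lborel. of_real (exp (- (a * t\<^sup>2))) * cis (t * \<sigma>))
       = (of_real (sqrt (pi / a) * exp (- (\<sigma>\<^sup>2 / (4 * a)))) :: complex)"
proof -
  \<comment> \<open>The substitution \<open>x = r * t\<close> turns \<open>x\<^sup>2 / 2\<close>
    into \<open>a * t\<^sup>2\<close>, and \<open>\<xi> = \<sigma> / r\<close> turns the phase into
    \<open>\<sigma> * t\<close>.\<close>
  define r where "r = sqrt (2 * a)"
  have r: "r > 0" "r\<^sup>2 = 2 * a" using a by (auto simp: r_def)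
  define \<xi> where "\<xi> = \<sigma> / r"
  have "(CLINT x|std_normal_distribution. iexp (\<xi> * x))
      = (LINT x|lborel. std_normal_density x *\<^sub>R iexp (\<xi> * x))"
    by (subst integral_density) (auto simp: normal_density_nonneg)
  then have "(LINT x|lborel. std_normal_density x *\<^sub>R iexp (\<xi> * x)) = of_real (exp (- \<xi>\<^sup>2 / 2))"
    using fun_cong[OF char_std_normal_distribution, of \<xi>] by (simp add: char_def)
  moreover have "(\<lambda>x. std_normal_density x *\<^sub>R iexp (\<xi> * x))
      = (\<lambda>x. of_real (1 / sqrt (2 * pi)) * (of_real (exp (- x\<^sup>2 / 2)) * cis (\<xi> * x)))"
    by (simp add: std_normal_density_def cis_conv_exp scaleR_conv_of_real)
  ultimately have *: "(LINT x|lborel. of_real (exp (- x\<^sup>2 / 2)) * cis (\<xi> * x))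
      = (of_real (sqrt (2 * pi) * exp (- \<xi>\<^sup>2 / 2)) :: complex)"
    by (simp add: field_simps)
  have "(LINT x|lborel. of_real (exp (- x\<^sup>2 / 2)) * cis (\<xi> * x) :: complex)
      = \<bar>r\<bar> *\<^sub>R (LINT t|lborel. of_real (exp (- (0 + r * t)\<^sup>2 / 2)) * cis (\<xi> * (0 + r * t)))"
    using r by (intro lborel_integral_real_affine) simp
  also have "\<dots> = of_real r * (LINT t|lborel. of_real (exp (- (a * t\<^sup>2))) * cis (t * \<sigma>))"
    using r by (simp add: power_mult_distrib \<xi>_def scaleR_conv_of_real mult.commute)
  finally have "(LINT t|lborel. of_real (exp (- (a * t\<^sup>2))) * cis (t * \<sigma>))
      = (of_real (sqrt (2 * pi) * exp (- \<xi>\<^sup>2 / 2) / r) :: complex)"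
    using * r by (simp add: field_simps)
  moreover have "sqrt (2 * pi) / r = sqrt (pi / a)"
    unfolding r_def by (simp add: real_sqrt_divide[symmetric])
  moreover have "\<xi>\<^sup>2 / 2 = \<sigma>\<^sup>2 / (4 * a)"
    using r by (simp add: \<xi>_def power_divide)
  ultimately show ?thesis
    by (metis (no_types, lifting) minus_divide_left times_divide_eq_left mult.commute)
qed

lemma st_fourier_wave:
  assumes "L > 0" "a > 0"
  shows "st_fourier L (wave a L N \<omega>) = wave_hat a N \<omega>"
proof (intro ext)
  fix \<tau> n
  have "fourier_coeff L (wave a L N \<omega> t) n
      = of_real (exp (- (a * t\<^sup>2))) * cis (\<omega> * t) * (if n = N then 1 else 0)" for t
  proof -
    have "fourier_coeff L (wave a L N \<omega> t) n = of_real (exp (- (a * t\<^sup>2))) * cis (\<omega> * t) *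
        fourier_coeff L (\<lambda>x. cis (2 * pi * of_int N * x / L)) n"
      unfolding fourier_coeff_def wave_def cis_mult[symmetric]
      by (subst times_divide_eq_right, subst set_integral_mult_right[symmetric])
         (simp add: mult_ac)
    then show ?thesis
      by (simp only: fourier_coeff_cis[OF assms(1)])
  qed
  then have "st_fourier L (wave a L N \<omega>) \<tau> n
      = (if n = N then (LINT t|lborel. of_real (exp (- (a * t\<^sup>2))) * cis (t * (\<omega> - \<tau>))) else 0)"
    by (simp add: st_fourier_def mult.assoc cis_mult right_diff_distrib mult.commute[of _ \<omega>])
  also have "\<dots> = wave_hat a N \<omega> \<tau> n"
    by (simp add: integral_gaussian_cis[OF assms(2)] wave_hat_def power2_commute)
  finally show "st_fourier L (wave a L N \<omega>) \<tau> n = wave_hat a N \<omega> \<tau> n" .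
qed

lemma integrable_gaussian: "a > 0 \<Longrightarrow> integrable lborel (\<lambda>t. exp (- (a * t\<^sup>2)) :: real)"
proof -
  assume a: "a > 0"
  define r where "r = sqrt (2 * a)"
  have r: "r \<noteq> 0" "r\<^sup>2 = 2 * a" using a by (auto simp: r_def)
  have "integrable lborel (\<lambda>x. sqrt (2 * pi) * std_normal_density x)"
    using integrable_std_normal_moment[of 0] by simp
  then have "integrable lborel (\<lambda>x. exp (- x\<^sup>2 / 2) :: real)"
    by (simp add: std_normal_density_def)
  from lborel_integrable_real_affine[OF this r(1), of 0] show ?thesis
    using r by (simp add: power_mult_distrib)
qed

lemma wave_periodic_integrable:
  assumes L: "L > 0" and a: "a > 0"
  shows "wave a L N \<omega> \<in> periodic_integrable L"
proof -
  have per: "wave a L N \<omega> t (x + L) = wave a L N \<omega> t x" for t x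
  proof -
    have "cis (2 * pi * of_int N * (x + L) / L + \<omega> * t)
        = cis (2 * pi * of_int N * x / L + \<omega> * t) * cis (2 * pi * of_int N)"
      using L by (simp add: cis_mult field_simps)
    then show ?thesis by (simp add: wave_def cis_multiple_2pi)
  qed
  \<comment> \<open>\<open>F\<close> is the modulus of the wave on the strip and 0 elsewhere; it
    dominates the wave there.\<close>
  define F where "F = (\<lambda>(t, x). exp (- (a * t\<^sup>2)) * indicator {0..L} x :: real)"
  have "integrable (lborel \<Otimes>\<^sub>M lborel) F"
  proof (rule lborel_pair.Fubini_integrable)
    show "F \<in> borel_measurable (lborel \<Otimes>\<^sub>M lborel)"
      unfolding F_def by measurable
    show "integrable lborel (\<lambda>t. LINT x|lborel. norm (F (t, x)))"
      using L integrable_gaussian[OF a] by (simp add: F_def abs_mult)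
    show "AE t in lborel. integrable lborel (\<lambda>x. F (t, x))"
      using L by (simp add: F_def)
  qed
  then have "integrable lborel F"
    by (simp add: lborel_prod)
  then have "set_integrable lborel (UNIV \<times> {0..L}) (\<lambda>(t, x). wave a L N \<omega> t x)"
    unfolding set_integrable_def
  proof (rule Bochner_Integration.integrable_bound)
    have "(\<lambda>p. wave a L N \<omega> (fst p) (snd p)) \<in> borel_measurable borel"
      unfolding wave_def cis_conv_exp by (intro borel_measurable_continuous_onI continuous_intros) (use L in auto)
    moreover have "closed (UNIV \<times> {0..L} :: (real \<times> real) set)"
      by (intro closed_Times) auto
    ultimately show "(\<lambda>p. indicator (UNIV \<times> {0..L}) p *\<^sub>R (case p of (t, x) \<Rightarrow> wave a L N \<omega> t x))
        \<in> borel_measurable lborel"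
      by (auto simp: case_prod_beta' intro!: borel_measurable_scaleR borel_measurable_indicator)
  qed (auto simp: F_def wave_def norm_mult indicator_def)
  then show ?thesis
    using per by (simp add: periodic_integrable_def)
qed

section \<open>Bourgain norms of single modes\<close>

lemma ennreal_sqrt_mono: "x \<le> y \<Longrightarrow> ennreal_sqrt x \<le> ennreal_sqrt y"
  by (auto simp: ennreal_sqrt_def top_unique intro!: ennreal_leI enn2real_mono)
     (simp add: less_top)

lemma ennreal_sqrt_power2: "0 \<le> x \<Longrightarrow> ennreal_sqrt (ennreal (x\<^sup>2)) = ennreal x"
  by (simp add: ennreal_sqrt_def)

lemma bourgain_norm_single_mode:
  assumes "\<And>\<tau> n. n \<noteq> N \<Longrightarrow> U \<tau> n = 0"
  shows "bourgain_norm h s b U = ennreal_sqrt (\<integral>\<^sup>+ \<tau>.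
       ennreal (jap (\<tau> + h N) powr (2 * b) * jap (of_int N) powr (2 * s) * (cmod (U \<tau> N))\<^sup>2) \<partial>lborel)"
  unfolding bourgain_norm_def
  by (subst infsum_cong_neutral[where T = "{N}" and
        g = "\<lambda>n. \<integral>\<^sup>+ \<tau>. ennreal (jap (\<tau> + h n) powr (2 * b) * jap (of_int n) powr (2 * s) *
          (cmod (U \<tau> n))\<^sup>2) \<partial>lborel"]) (auto simp: assms)

text \<open>A wave on the curve \<open>\<tau> = - h N\<close> has, after translation in
  \<open>\<tau>\<close>, a weighted integral in which \<open>h\<close> and \<open>N\<close> no
  longer occur. Hence one \<open>A\<close> serves both kinds of curve and all frequencies. The rate
  1/2 is that of the input waves.\<close>

lemma wave_hat_norm_upper:
  "\<exists>A>0. \<forall>h s N. bourgain_norm h s (1/2) (wave_hat (1/2) N (- h N)) \<le> ennreal (A * jap (of_int N) powr s)"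
proof -
  define G where "G = (\<integral>\<^sup>+ \<tau>. ennreal (exp (- ((1/2) * \<tau>\<^sup>2))) \<partial>lborel)"
  have "G < \<infinity>"
    using integrable_gaussian[of "1/2"] unfolding G_def integrable_iff_bounded by simp
  then obtain g where g: "G = ennreal g" "0 \<le> g"
    by (metis ennreal_cases infinity_ennreal_def less_irrefl)
  \<comment> \<open>The summand 1 gives \<open>A > 0\<close> without a proof that \<open>g\<close>
    is positive.\<close>
  define A where "A = sqrt (4 * pi * g) + 1"
  have "bourgain_norm h s (1/2) (wave_hat (1/2) N (- h N)) \<le> ennreal (A * jap (of_int N) powr s)"
    for h s N
  proof -
    define j where "j = jap (of_int N) powr s"
    have j: "0 \<le> j" "jap (of_int N) powr (2 * s) = j\<^sup>2"
      by (auto simp: j_def power2_eq_square powr_add[symmetric])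
    have "(\<integral>\<^sup>+ \<tau>. ennreal (jap (\<tau> + h N) powr (2 * (1/2)) * jap (of_int N) powr (2 * s) *
          (cmod (wave_hat (1/2) N (- h N) \<tau> N))\<^sup>2) \<partial>lborel)
        = (\<integral>\<^sup>+ \<tau>. ennreal (jap (\<tau> + h N) * j\<^sup>2 * (2 * pi * (exp (- ((\<tau> + h N)\<^sup>2 / 2)))\<^sup>2)) \<partial>lborel)"
      unfolding j(2) by (simp add: wave_hat_def norm_mult power_mult_distrib less_imp_le mult.commute[of pi])
    also have "\<dots> = (\<integral>\<^sup>+ \<tau>. ennreal (jap \<tau> * j\<^sup>2 * (2 * pi * (exp (- (\<tau>\<^sup>2 / 2)))\<^sup>2)) \<partial>lborel)"
      using nn_integral_real_affine[of "\<lambda>\<tau>. ennreal (jap \<tau> * j\<^sup>2 * (2 * pi * (exp (- (\<tau>\<^sup>2 / 2)))\<^sup>2))" 1 "h N"]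
      by (simp add: jap_def add.commute)
    also have "\<dots> \<le> (\<integral>\<^sup>+ \<tau>. ennreal (4 * pi * j\<^sup>2) * ennreal (exp (- ((1/2) * \<tau>\<^sup>2))) \<partial>lborel)"
    proof (rule nn_integral_mono)
      fix \<tau> :: real
      \<comment> \<open>The weight grows at most like \<open>2 * exp (\<tau>\<^sup>2 / 2)\<close>,
        which half of the decay of the squared Gaussian absorbs.\<close>
      have "\<bar>\<tau>\<bar> \<le> 1 / 2 + \<tau>\<^sup>2 / 2"
        using zero_le_power2[of "\<bar>\<tau>\<bar> - 1"] by (simp add: power2_eq_square algebra_simps)
      then have "jap \<tau> \<le> 2 * (1 + \<tau>\<^sup>2 / 2)"
        unfolding jap_def by (simp add: algebra_simps)
      also have "\<dots> \<le> 2 * exp (\<tau>\<^sup>2 / 2)"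
        by (intro mult_left_mono exp_ge_add_one_self) auto
      finally have "jap \<tau> * (j\<^sup>2 * (2 * pi * (exp (- (\<tau>\<^sup>2 / 2)))\<^sup>2))
          \<le> 2 * exp (\<tau>\<^sup>2 / 2) * (j\<^sup>2 * (2 * pi * (exp (- (\<tau>\<^sup>2 / 2)))\<^sup>2))"
        by (intro mult_right_mono) auto
      also have "\<dots> = 4 * pi * j\<^sup>2 * exp (- (1/2 * \<tau>\<^sup>2))"
        by (simp add: power2_eq_square exp_minus)
      finally show "ennreal (jap \<tau> * j\<^sup>2 * (2 * pi * (exp (- (\<tau>\<^sup>2 / 2)))\<^sup>2))
          \<le> ennreal (4 * pi * j\<^sup>2) * ennreal (exp (- (1/2 * \<tau>\<^sup>2)))"
        by (subst ennreal_mult[symmetric]) (auto intro!: ennreal_leI simp: mult.assoc)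
    qed
    also have "\<dots> = ennreal (4 * pi * j\<^sup>2) * G"
      unfolding G_def by (rule nn_integral_cmult) simp
    also have "\<dots> = ennreal ((sqrt (4 * pi * g) * j)\<^sup>2)"
      using g by (simp add: ennreal_mult[symmetric] power_mult_distrib mult_ac)
    also have "\<dots> \<le> ennreal ((A * j)\<^sup>2)"
      using g j by (intro ennreal_leI power_mono mult_right_mono) (auto simp: A_def)
    finally have "bourgain_norm h s (1/2) (wave_hat (1/2) N (- h N)) \<le> ennreal_sqrt (ennreal ((A * j)\<^sup>2))"
      by (subst bourgain_norm_single_mode[where N = N]) (auto simp: wave_hat_def intro!: ennreal_sqrt_mono)
    moreover have "0 \<le> A * j" using g j by (simp add: A_def)
    ultimately show ?thesis
      by (simp add: ennreal_sqrt_power2 j_def)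
  qed
  moreover have "A > 0" using g by (simp add: A_def add_nonneg_pos)
  ultimately show ?thesis by blast
qed

text \<open>Restricting the integral to the unit interval from \<open>\<omega>\<close> suffices:
  within distance 2 of the curve both weight and Gaussian are bounded below there. The rate 1 is
  that of a product of two input waves, and the multiplier \<open>c\<close> accommodates the symbol
  of the derivative.\<close>

lemma wave_hat_norm_lower:
  "\<exists>B>0. \<forall>h s N \<omega> c. \<bar>\<omega> + h N\<bar> \<le> 2 \<longrightarrow>
     ennreal (B * cmod (c N) * jap (of_int N) powr s) \<le> bourgain_norm h s b (\<lambda>\<tau> n. c n * wave_hat 1 N \<omega> \<tau> n)"
proof -
  \<comment> \<open>The three factors bound the weight, the squared amplitude \<open>pi / a\<close>
    at \<open>a = 1\<close>, and the squared Gaussian at distance at most 1 from its centre.\<close>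
  define B where "B = sqrt (4 powr (- \<bar>2 * b\<bar>) * pi * exp (- 1 / 2))"
  have B: "B > 0" "B\<^sup>2 = 4 powr (- \<bar>2 * b\<bar>) * pi * exp (- 1 / 2)"
    by (simp_all add: B_def)
  have "ennreal (B * cmod (c N) * jap (of_int N) powr s)
      \<le> bourgain_norm h s b (\<lambda>\<tau> n. c n * wave_hat 1 N \<omega> \<tau> n)"
    if \<omega>: "\<bar>\<omega> + h N\<bar> \<le> 2" for h s N \<omega> and c :: "int \<Rightarrow> complex"
  proof -
    define j where "j = jap (of_int N) powr s"
    have j: "0 \<le> j" "jap (of_int N) powr (2 * s) = j\<^sup>2"
      by (auto simp: j_def power2_eq_square powr_add[symmetric])
    define D where "D = (B * cmod (c N) * j)\<^sup>2"
    have "ennreal D = (\<integral>\<^sup>+ \<tau>. ennreal D * indicator {\<omega>..\<omega> + 1} \<tau> \<partial>lborel)"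
      by (subst nn_integral_cmult_indicator) auto
    also have "\<dots> \<le> (\<integral>\<^sup>+ \<tau>. ennreal (jap (\<tau> + h N) powr (2 * b) * jap (of_int N) powr (2 * s) *
          (cmod (c N * wave_hat 1 N \<omega> \<tau> N))\<^sup>2) \<partial>lborel)"
    proof (rule nn_integral_mono)
      fix \<tau>
      show "ennreal D * indicator {\<omega>..\<omega> + 1} \<tau> \<le> ennreal (jap (\<tau> + h N) powr (2 * b) *
          jap (of_int N) powr (2 * s) * (cmod (c N * wave_hat 1 N \<omega> \<tau> N))\<^sup>2)"
      proof (cases "\<tau> \<in> {\<omega>..\<omega> + 1}")
        case True
        have "jap (\<tau> + h N) \<le> 4"
          using True \<omega> by (auto simp: jap_def)
        \<comment> \<open>Comparing the bracket with 1 gives a lower bound whatever the sign of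
          \<open>b\<close>.\<close>
        then have "1 powr (2 * b) \<le> 4 powr \<bar>2 * b\<bar> * jap (\<tau> + h N) powr (2 * b)"
          using jap_ge_1[of "\<tau> + h N"] by (intro powr_comparable) auto
        then have 1: "4 powr (- \<bar>2 * b\<bar>) \<le> jap (\<tau> + h N) powr (2 * b)"
          by (simp add: powr_minus field_simps)
        have "\<bar>\<tau> - \<omega>\<bar> \<le> 1" using True by auto
        then have "(\<tau> - \<omega>)\<^sup>2 \<le> 1" by (simp add: abs_square_le_1)
        then have 2: "exp (- 1 / 2) \<le> exp (- ((\<tau> - \<omega>)\<^sup>2 / 2))" by simp
        have "(exp (- ((\<tau> - \<omega>)\<^sup>2 / 4)))\<^sup>2 = exp (- ((\<tau> - \<omega>)\<^sup>2 / 2))"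
          by (simp add: exp_double[symmetric])
        then have 3: "(cmod (c N * wave_hat 1 N \<omega> \<tau> N))\<^sup>2
            = (cmod (c N))\<^sup>2 * (pi * exp (- ((\<tau> - \<omega>)\<^sup>2 / 2)))"
          by (simp add: wave_hat_def norm_mult power_mult_distrib)
        have "D = 4 powr (- \<bar>2 * b\<bar>) * j\<^sup>2 * ((cmod (c N))\<^sup>2 * (pi * exp (- 1 / 2)))"
          by (simp add: D_def power_mult_distrib B(2))
        also have "\<dots> \<le> jap (\<tau> + h N) powr (2 * b) * j\<^sup>2 *
            ((cmod (c N))\<^sup>2 * (pi * exp (- ((\<tau> - \<omega>)\<^sup>2 / 2))))"
          using 1 2 by (intro mult_mono) auto
        finally show ?thesis
          using True by (simp add: 3 j(2) ennreal_leI)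
      qed simp
    qed
    finally have "ennreal_sqrt (ennreal D) \<le> bourgain_norm h s b (\<lambda>\<tau> n. c n * wave_hat 1 N \<omega> \<tau> n)"
      by (subst bourgain_norm_single_mode[where N = N]) (auto simp: wave_hat_def intro!: ennreal_sqrt_mono)
    then show ?thesis
      using B j by (simp add: D_def ennreal_sqrt_power2 j_def)
  qed
  then show ?thesis using B(1) by blast
qed

section \<open>Resonant frequency pairs and tools for the contradiction\<close>

text \<open>The frequencies \<open>M\<close> and \<open>K + M\<close> follow the slopes
  \<open>\<alpha>\<close> and \<open>\<alpha> + 1\<close>, both nonzero, so their brackets are
  comparable to that of \<open>K\<close>. The constant \<open>\<kappa>\<close> is fixed before
  \<open>R\<close>, hence uniform along the sequence.\<close>

lemma resonant_frequencies:
  fixes \<alpha> :: real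
  assumes "\<alpha> \<noteq> 0" "\<alpha> \<noteq> - 1"
  obtains \<kappa> :: real where "\<And>R. \<exists>K M :: int. 1 \<le> K \<and> R < jap (of_int K) \<and>
    \<bar>of_int K * (of_int M - \<alpha> * of_int K)\<bar> \<le> 1 \<and>
    (\<forall>s. jap (of_int K) powr s \<le> \<kappa> powr \<bar>s\<bar> * jap (of_int (K + M)) powr s) \<and>
    (\<forall>s. jap (of_int (K + M)) powr s \<le> \<kappa> powr \<bar>s\<bar> * jap (of_int K) powr s) \<and>
    (\<forall>s. jap (of_int M) powr s \<le> \<kappa> powr \<bar>s\<bar> * jap (of_int K) powr s)"
proof
  \<comment> \<open>The sum of the constants for the two slopes dominates each of them.\<close>
  define \<kappa> where "\<kappa> = (2 + \<bar>\<alpha>\<bar> + 2 / \<bar>\<alpha>\<bar>) + (2 + \<bar>\<alpha> + 1\<bar> + 2 / \<bar>\<alpha> + 1\<bar>)"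
  fix R :: real
  obtain K M :: int where K: "1 \<le> K" "R < of_int K"
    and KM: "\<bar>of_int K * (of_int M - \<alpha> * of_int K)\<bar> \<le> 1"
    using bounded_resonance_unbounded[of R \<alpha>] by blast
  have "1 * \<bar>of_int M - \<alpha> * of_int K\<bar> \<le> of_int K * \<bar>of_int M - \<alpha> * of_int K\<bar>"
    using K by (intro mult_right_mono) auto
  then have M: "\<bar>of_int M - \<alpha> * of_int K\<bar> \<le> 1"
    using KM K by (simp add: abs_mult)
  then have "\<bar>of_int (K + M) - (\<alpha> + 1) * of_int K\<bar> \<le> 1"
    by (simp add: algebra_simps)
  note comparable = jap_of_int_comparable[OF K(1) M, of \<kappa>] jap_of_int_comparable[OF K(1) this, of \<kappa>]
  have "jap (of_int M) \<le> \<kappa> * jap (of_int K)" "jap (of_int K) \<le> \<kappa> * jap (of_int M)"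
    "jap (of_int (K + M)) \<le> \<kappa> * jap (of_int K)" "jap (of_int K) \<le> \<kappa> * jap (of_int (K + M))"
    by (rule comparable; use assms in \<open>simp add: \<kappa>_def add_eq_0_iff2\<close>)+
  then have "jap (of_int K) powr s \<le> \<kappa> powr \<bar>s\<bar> * jap (of_int (K + M)) powr s"
    "jap (of_int (K + M)) powr s \<le> \<kappa> powr \<bar>s\<bar> * jap (of_int K) powr s"
    "jap (of_int M) powr s \<le> \<kappa> powr \<bar>s\<bar> * jap (of_int K) powr s" for s
    by (auto intro!: powr_comparable)
  moreover have "R < jap (of_int K)" using K by (simp add: jap_def)
  ultimately show "\<exists>K M :: int. 1 \<le> K \<and> R < jap (of_int K) \<and>
    \<bar>of_int K * (of_int M - \<alpha> * of_int K)\<bar> \<le> 1 \<and>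
    (\<forall>s. jap (of_int K) powr s \<le> \<kappa> powr \<bar>s\<bar> * jap (of_int (K + M)) powr s) \<and>
    (\<forall>s. jap (of_int (K + M)) powr s \<le> \<kappa> powr \<bar>s\<bar> * jap (of_int K) powr s) \<and>
    (\<forall>s. jap (of_int M) powr s \<le> \<kappa> powr \<bar>s\<bar> * jap (of_int K) powr s)"
    using K KM by blast
qed

lemma powr_unbounded:
  fixes p D :: real
  assumes "p > 0"
  obtains R where "\<And>x. 0 < x \<Longrightarrow> R < x \<Longrightarrow> D < x powr p"
proof
  fix x :: real
  assume "0 < x" "(\<bar>D\<bar> + 1) powr (1 / p) < x"
  then have "((\<bar>D\<bar> + 1) powr (1 / p)) powr p < x powr p"
    using assms by (intro powr_less_mono2) auto
  then show "D < x powr p"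
    using assms by (simp add: powr_powr)
qed

text \<open>The passage from extended norms to a real inequality. \<open>ennreal C\<close> is 0 for
  negative \<open>C\<close>, so \<open>\<bar>C\<bar>\<close> avoids a case split on the
  sign.\<close>

lemma ennreal_estimate_real:
  assumes "ennreal x \<le> X" "X \<le> ennreal C * (Y * Z)" "Y \<le> ennreal y" "Z \<le> ennreal z"
    and "0 \<le> y" "0 \<le> z"
  shows "x \<le> \<bar>C\<bar> * (y * z)"
proof -
  have "ennreal x \<le> ennreal C * (Y * Z)" using assms(1,2) by (rule order_trans)
  also have "\<dots> \<le> ennreal \<bar>C\<bar> * (ennreal y * ennreal z)"
    using assms by (intro mult_mono ennreal_leI) auto
  also have "\<dots> = ennreal (\<bar>C\<bar> * (y * z))"
    using assms by (simp add: ennreal_mult[symmetric])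
  finally show ?thesis
    using assms by (subst (asm) ennreal_le_iff) auto
qed

section \<open>The two counterexamples\<close>

theorem proposition3p4:
  fixes L \<gamma> :: real
  assumes "L > 0" and "\<gamma> \<noteq> 0" and "\<bar>\<gamma>\<bar> \<noteq> 1"
  shows
    "(\<forall>s < 1/2. \<forall>\<^sub>F \<epsilon> in at_right (0::real).
        \<not> (\<exists>C::real. \<forall>u \<in> periodic_integrable L. \<forall>v \<in> periodic_integrable L.
              (\<lambda>t x. u t x * v t x) \<in> periodic_integrable L \<longrightarrow>
              Y_norm \<gamma> (s - 1/2) (1/2) (st_fourier L u) < \<infinity> \<longrightarrow>
              X_norm s (1/2) (st_fourier L v) < \<infinity> \<longrightarrow>
              X_norm s (- 1/2 + \<epsilon>) (st_fourier L (\<lambda>t x. u t x * v t x))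
                \<le> ennreal C * (Y_norm \<gamma> (s - 1/2) (1/2) (st_fourier L u)
                              * X_norm s (1/2) (st_fourier L v))))
   \<and> (\<forall>s < 1/2. \<forall>\<^sub>F \<epsilon> in at_right (0::real).
        \<not> (\<exists>C::real. \<forall>u \<in> periodic_integrable L. \<forall>v \<in> periodic_integrable L.
              (\<lambda>t x. u t x * cnj (v t x)) \<in> periodic_integrable L \<longrightarrow>
              X_norm s (1/2) (st_fourier L u) < \<infinity> \<longrightarrow>
              X_norm s (1/2) (st_fourier L v) < \<infinity> \<longrightarrow>
              Y_norm \<gamma> (s - 1/2) (- 1/2 + \<epsilon>)
                  (dx_hat L (st_fourier L (\<lambda>t x. u t x * cnj (v t x))))
                \<le> ennreal C * (X_norm s (1/2) (st_fourier L u)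
                              * X_norm s (1/2) (st_fourier L v))))"
proof (intro conjI allI impI always_eventually notI)
  \<comment> \<open>For \<open>K > 0\<close> the resonance
    \<open>(K + M)\<^sup>2 - M\<^sup>2 - \<gamma> * K\<^sup>2\<close> equals
    \<open>2 * K * (M - \<alpha> * K)\<close>. The excluded values 1 and -1 of
    \<open>\<gamma>\<close> correspond to \<open>\<alpha> = 0\<close> and
    \<open>\<alpha> = - 1\<close>.\<close>
  define \<alpha> where "\<alpha> = (\<gamma> - 1) / 2"
  have \<alpha>: "\<alpha> \<noteq> 0" "\<alpha> \<noteq> - 1"
    using assms(3) by (auto simp: \<alpha>_def)
  define hY where "hY = (\<lambda>n::int. \<gamma> * \<bar>of_int n\<bar> * of_int n)"
  define hX where "hX = (\<lambda>n::int. (of_int n :: real)\<^sup>2)"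
  have Ynorm: "Y_norm \<gamma> = bourgain_norm hY" and Xnorm: "X_norm = bourgain_norm hX"
    by (simp_all add: fun_eq_iff Y_norm_def X_norm_def hY_def hX_def)
  obtain \<kappa> :: real where freq: "\<And>R. \<exists>K M :: int. 1 \<le> K \<and> R < jap (of_int K) \<and>
    \<bar>of_int K * (of_int M - \<alpha> * of_int K)\<bar> \<le> 1 \<and>
    (\<forall>s. jap (of_int K) powr s \<le> \<kappa> powr \<bar>s\<bar> * jap (of_int (K + M)) powr s) \<and>
    (\<forall>s. jap (of_int (K + M)) powr s \<le> \<kappa> powr \<bar>s\<bar> * jap (of_int K) powr s) \<and>
    (\<forall>s. jap (of_int M) powr s \<le> \<kappa> powr \<bar>s\<bar> * jap (of_int K) powr s)"
    using resonant_frequencies[OF \<alpha>] by blast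
  obtain A where A: "A > 0" and upper: "\<And>h s N.
      bourgain_norm h s (1/2) (wave_hat (1/2) N (- h N)) \<le> ennreal (A * jap (of_int N) powr s)"
    using wave_hat_norm_upper by blast
  note wave_facts = st_fourier_wave[OF assms(1)] wave_periodic_integrable[OF assms(1)]
  have finite: "bourgain_norm h s (1/2) (wave_hat (1/2) N (- h N)) < \<infinity>" for h s N
    using upper[of h s N] by (simp add: order_le_less_trans[OF _ ennreal_less_top])
  \<comment> \<open>\<open>always_eventually\<close> has reduced both parts to an arbitrary
    \<open>\<epsilon>\<close>; the constant \<open>B\<close> below may depend on it, but not on the
    frequencies.\<close>
  fix s \<epsilon> :: real
  assume s: "s < 1 / 2"
  define \<mu> where "\<mu> = \<kappa> powr \<bar>s\<bar>"
  have \<mu>: "0 \<le> \<mu>" by (simp add: \<mu>_def)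
  obtain B where B: "B > 0" and lower: "\<And>h r N \<omega> c. \<bar>\<omega> + h N\<bar> \<le> 2 \<Longrightarrow>
      ennreal (B * cmod (c N) * jap (of_int N) powr r)
      \<le> bourgain_norm h r (- 1/2 + \<epsilon>) (\<lambda>\<tau> n. c n * wave_hat 1 N \<omega> \<tau> n)"
    using wave_hat_norm_lower[of "- 1/2 + \<epsilon>"] by blast
  { assume "\<exists>C::real. \<forall>u \<in> periodic_integrable L. \<forall>v \<in> periodic_integrable L.
              (\<lambda>t x. u t x * v t x) \<in> periodic_integrable L \<longrightarrow>
              Y_norm \<gamma> (s - 1/2) (1/2) (st_fourier L u) < \<infinity> \<longrightarrow>
              X_norm s (1/2) (st_fourier L v) < \<infinity> \<longrightarrow>
              X_norm s (- 1/2 + \<epsilon>) (st_fourier L (\<lambda>t x. u t x * v t x))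
                \<le> ennreal C * (Y_norm \<gamma> (s - 1/2) (1/2) (st_fourier L u)
                              * X_norm s (1/2) (st_fourier L v))"
    then obtain C :: real where C: "\<And>u v. u \<in> periodic_integrable L \<Longrightarrow> v \<in> periodic_integrable L \<Longrightarrow>
              (\<lambda>t x. u t x * v t x) \<in> periodic_integrable L \<Longrightarrow>
              Y_norm \<gamma> (s - 1/2) (1/2) (st_fourier L u) < \<infinity> \<Longrightarrow>
              X_norm s (1/2) (st_fourier L v) < \<infinity> \<Longrightarrow>
              X_norm s (- 1/2 + \<epsilon>) (st_fourier L (\<lambda>t x. u t x * v t x))
                \<le> ennreal C * (Y_norm \<gamma> (s - 1/2) (1/2) (st_fourier L u)
                              * X_norm s (1/2) (st_fourier L v))"
      by blast
    \<comment> \<open>\<open>D\<close> collects all constants, so that the assumed estimate becomes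
      \<open>k powr (1/2 - s) \<le> D\<close>.\<close>
    define D where "D = \<mu> * \<mu> * \<bar>C\<bar> * A * A / B"
    obtain R where R: "\<And>x. 0 < x \<Longrightarrow> R < x \<Longrightarrow> D < x powr (1/2 - s)"
      using powr_unbounded[of "1/2 - s" D] s by auto
    obtain K M :: int where KM: "1 \<le> K" "R < jap (of_int K)"
        "\<bar>of_int K * (of_int M - \<alpha> * of_int K)\<bar> \<le> 1"
        "jap (of_int K) powr s \<le> \<mu> * jap (of_int (K + M)) powr s"
        "jap (of_int M) powr s \<le> \<mu> * jap (of_int K) powr s"
      using freq[of R] unfolding \<mu>_def by blast
    define k where "k = jap (of_int K)"
    have k: "k > 0" by (simp add: k_def)
    \<comment> \<open>Each input sits on the curve of its own norm, so \<open>upper\<close> applies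
      to both.\<close>
    define u v where "u = wave (1/2) L K (- hY K)" and "v = wave (1/2) L M (- hX M)"
    have uv: "(\<lambda>t x. u t x * v t x) = wave 1 L (K + M) (- hY K - hX M)"
      by (simp add: u_def v_def wave_mult fun_eq_iff)
    \<comment> \<open>With the resonance at most 1, this is the distance bound 2 required by
      \<open>lower\<close>.\<close>
    have "\<bar>(- hY K - hX M) + hX (K + M)\<bar> = 2 * \<bar>of_int K * (of_int M - \<alpha> * of_int K)\<bar>"
    proof -
      have "(- hY K - hX M) + hX (K + M) = 2 * (of_int K * (of_int M - \<alpha> * of_int K))"
        using KM(1) by (simp add: hY_def hX_def \<alpha>_def power2_eq_square field_simps)
      then show ?thesis by (simp add: abs_mult)
    qed
    then have "ennreal (B * jap (of_int (K + M)) powr s)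
        \<le> bourgain_norm hX s (- 1/2 + \<epsilon>) (wave_hat 1 (K + M) (- hY K - hX M))"
      using lower[of "- hY K - hX M" hX "K + M" "\<lambda>_. 1" s] KM(3) by simp
    moreover have "bourgain_norm hX s (- 1/2 + \<epsilon>) (wave_hat 1 (K + M) (- hY K - hX M))
        \<le> ennreal C * (bourgain_norm hY (s - 1/2) (1/2) (wave_hat (1/2) K (- hY K))
          * bourgain_norm hX s (1/2) (wave_hat (1/2) M (- hX M)))"
      using C[of u v] finite[of hY "s - 1/2" K] finite[of hX s M] unfolding uv
      by (simp add: u_def v_def wave_facts Ynorm Xnorm)
    ultimately have "B * jap (of_int (K + M)) powr s
        \<le> \<bar>C\<bar> * ((A * k powr (s - 1/2)) * (A * jap (of_int M) powr s))"
      unfolding k_def by (rule ennreal_estimate_real[OF _ _ upper upper]) (use A in auto)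
    also have "\<dots> \<le> \<bar>C\<bar> * ((A * k powr (s - 1/2)) * (A * (\<mu> * k powr s)))"
      using KM(5) A by (intro mult_left_mono) (auto simp: k_def)
    finally have 1: "B * jap (of_int (K + M)) powr s
        \<le> \<bar>C\<bar> * ((A * k powr (s - 1/2)) * (A * (\<mu> * k powr s)))" .
    \<comment> \<open>Moving the output bracket from \<open>K + M\<close> to \<open>K\<close> lets
      \<open>k powr s\<close> cancel; what remains is the gain \<open>k powr (s - 1/2)\<close> from
      the norm of \<open>u\<close>.\<close>
    have "B * k powr s \<le> \<mu> * (B * jap (of_int (K + M)) powr s)"
      using KM(4) B by (simp add: k_def mult.left_commute)
    also have "\<dots> \<le> \<mu> * (\<bar>C\<bar> * ((A * k powr (s - 1/2)) * (A * (\<mu> * k powr s))))"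
      by (rule mult_left_mono[OF 1 \<mu>])
    also have "\<dots> = B * D * k powr (s - 1/2) * k powr s"
      using B by (simp add: D_def)
    finally have "1 \<le> D * k powr (s - 1/2)"
      using B k by simp
    also have "k powr (s - 1/2) = inverse (k powr (1/2 - s))"
      by (simp add: powr_minus[symmetric])
    finally have "k powr (1/2 - s) \<le> D"
      using k by (simp add: field_simps)
    then show False
      using R[OF k] KM(2) by (simp add: k_def)
  next
    assume "\<exists>C::real. \<forall>u \<in> periodic_integrable L. \<forall>v \<in> periodic_integrable L.
              (\<lambda>t x. u t x * cnj (v t x)) \<in> periodic_integrable L \<longrightarrow>
              X_norm s (1/2) (st_fourier L u) < \<infinity> \<longrightarrow>
              X_norm s (1/2) (st_fourier L v) < \<infinity> \<longrightarrow>
              Y_norm \<gamma> (s - 1/2) (- 1/2 + \<epsilon>)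
                  (dx_hat L (st_fourier L (\<lambda>t x. u t x * cnj (v t x))))
                \<le> ennreal C * (X_norm s (1/2) (st_fourier L u)
                              * X_norm s (1/2) (st_fourier L v))"
    then obtain C :: real where C: "\<And>u v. u \<in> periodic_integrable L \<Longrightarrow> v \<in> periodic_integrable L \<Longrightarrow>
              (\<lambda>t x. u t x * cnj (v t x)) \<in> periodic_integrable L \<Longrightarrow>
              X_norm s (1/2) (st_fourier L u) < \<infinity> \<Longrightarrow>
              X_norm s (1/2) (st_fourier L v) < \<infinity> \<Longrightarrow>
              Y_norm \<gamma> (s - 1/2) (- 1/2 + \<epsilon>)
                  (dx_hat L (st_fourier L (\<lambda>t x. u t x * cnj (v t x))))
                \<le> ennreal C * (X_norm s (1/2) (st_fourier L u)
                              * X_norm s (1/2) (st_fourier L v))"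
      by blast
    \<comment> \<open>The symbol of the derivative at \<open>K\<close> has modulus
      \<open>2 * pi * K / L\<close>, at least \<open>(pi / L) * k\<close> because
      \<open>k = 1 + K \<le> 2 * K\<close>.\<close>
    define E where "E = B * (pi / L)"
    have E: "E > 0" using B assms(1) by (simp add: E_def)
    define D where "D = \<mu> * \<mu> * \<bar>C\<bar> * A * A / E"
    obtain R where R: "\<And>x. 0 < x \<Longrightarrow> R < x \<Longrightarrow> D < x powr (1/2 - s)"
      using powr_unbounded[of "1/2 - s" D] s by auto
    obtain K M :: int where KM: "1 \<le> K" "R < jap (of_int K)"
        "\<bar>of_int K * (of_int M - \<alpha> * of_int K)\<bar> \<le> 1"
        "jap (of_int (K + M)) powr s \<le> \<mu> * jap (of_int K) powr s"
        "jap (of_int M) powr s \<le> \<mu> * jap (of_int K) powr s"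
      using freq[of R] unfolding \<mu>_def by blast
    define k where "k = jap (of_int K)"
    have k: "k > 0" by (simp add: k_def)
    \<comment> \<open>Conjugation sends frequency \<open>M\<close> to \<open>- M\<close>, so the
      product has frequency \<open>K\<close>, and its distance to the \<open>Y\<close> curve is
      again governed by the same resonance.\<close>
    define u v where "u = wave (1/2) L (K + M) (- hX (K + M))" and "v = wave (1/2) L M (- hX M)"
    have uv: "(\<lambda>t x. u t x * cnj (v t x)) = wave 1 L K (- hX (K + M) + hX M)"
      by (simp add: u_def v_def cnj_wave wave_mult fun_eq_iff)
    define c where "c = (\<lambda>n::int. 2 * of_real pi * \<i> * of_int n / of_real L :: complex)"
    have dx: "dx_hat L W = (\<lambda>\<tau> n. c n * W \<tau> n)" for W
      by (simp add: dx_hat_def c_def fun_eq_iff)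
    have "cmod (c K) = 2 * pi / L * of_int K"
      using assms(1) KM(1) by (simp add: c_def norm_mult norm_divide)
    moreover have "k \<le> 2 * of_int K"
      using KM(1) by (simp add: k_def jap_def)
    then have "pi / L * k \<le> pi / L * (2 * of_int K)"
      using assms(1) by (intro mult_left_mono) auto
    ultimately have ck: "pi / L * k \<le> cmod (c K)" by (simp add: mult_ac)
    have "\<bar>(- hX (K + M) + hX M) + hY K\<bar> = 2 * \<bar>of_int K * (of_int M - \<alpha> * of_int K)\<bar>"
    proof -
      have "(- hX (K + M) + hX M) + hY K = - (2 * (of_int K * (of_int M - \<alpha> * of_int K)))"
        using KM(1) by (simp add: hY_def hX_def \<alpha>_def power2_eq_square field_simps)
      then show ?thesis by (simp add: abs_mult)
    qed
    then have "ennreal (B * cmod (c K) * k powr (s - 1/2))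
        \<le> bourgain_norm hY (s - 1/2) (- 1/2 + \<epsilon>) (dx_hat L (wave_hat 1 K (- hX (K + M) + hX M)))"
      unfolding dx k_def using KM(3) by (intro lower) simp
    moreover have "bourgain_norm hY (s - 1/2) (- 1/2 + \<epsilon>) (dx_hat L (wave_hat 1 K (- hX (K + M) + hX M)))
        \<le> ennreal C * (bourgain_norm hX s (1/2) (wave_hat (1/2) (K + M) (- hX (K + M)))
          * bourgain_norm hX s (1/2) (wave_hat (1/2) M (- hX M)))"
      using C[of u v] finite[of hX s "K + M"] finite[of hX s M] unfolding uv
      by (simp add: u_def v_def wave_facts Ynorm Xnorm)
    ultimately have 1: "B * cmod (c K) * k powr (s - 1/2)
        \<le> \<bar>C\<bar> * ((A * jap (of_int (K + M)) powr s) * (A * jap (of_int M) powr s))"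
      by (rule ennreal_estimate_real[OF _ _ upper upper]) (use A in auto)
    \<comment> \<open>The derivative contributes a full power of \<open>k\<close>: the left side
      grows like \<open>k powr (s + 1/2)\<close>, the right side like \<open>k powr (2 * s)\<close>,
      and their ratio is \<open>k powr (1/2 - s)\<close>.\<close>
    have "E * k * k powr (s - 1/2) \<le> B * cmod (c K) * k powr (s - 1/2)"
      using mult_left_mono[OF ck, of B] B by (intro mult_right_mono) (auto simp: E_def mult.assoc)
    also note 1
    also have "\<bar>C\<bar> * ((A * jap (of_int (K + M)) powr s) * (A * jap (of_int M) powr s))
        \<le> \<bar>C\<bar> * ((A * (\<mu> * k powr s)) * (A * (\<mu> * k powr s)))"
      using KM(4,5) A \<mu> by (intro mult_left_mono mult_mono) (auto simp: k_def)
    also have "\<dots> = E * D * (k powr s * k powr s)"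
      using E by (simp add: D_def)
    finally have "k powr 1 * k powr (s - 1/2) \<le> D * (k powr s * k powr s)"
      using E k by (simp add: mult.assoc)
    also have "k powr 1 * k powr (s - 1/2) = k powr (1/2 - s) * (k powr s * k powr s)"
      unfolding powr_add[symmetric] by (simp add: field_simps)
    finally have "k powr (1/2 - s) \<le> D"
      using k by simp
    then show False
      using R[OF k] KM(2) by (simp add: k_def)
  }
qed

end
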